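(* Let $G$ be a finite irreducible Coxeter group. Then (i) $\mathrm{DNG}(G)=*1$ if $G$ is of type $A_1$; (ii) $\mathrm{DNG}(G)=*3$ if $G$ is of type $I_2(m)$ for some odd $m$; (iii) $\mathrm{DNG}(G)=*0$ otherwise.
   Context: The Coxeter group of type $A_n$ is isomorphic to the symmetric group on $n+1$ letters, and the Coxeter group of type $I_2(m)$ ($m\ge 3$) is the dihedral group of order $2m$; type $A_2$ is regarded as type $I_2(3)$. For a nontrivial finite group $G$, the avoidance game $\mathrm{DNG}(G)$ is the impartial game whose positions are the subsets $P\subseteq G$ with $\langle P\rangle\ne G$; the starting position is $\emptyset$; the options of $P$ are the positions of the form $P\cup\{g\}$ with $g\in G\setminus P$ (and $\langle P\cup\{g\}\rangle\neq G$). Two players alternate moves, and a player who cannot move loses (normal play). The nim-number of a position $P$ is defined recursively by $\mathrm{nim}(P)=\mathrm{mex}\{\mathrm{nim}(Q)\mid Q \text{ an option of } P\}$, where $\mathrm{mex}(A)$ is the least non-negative integer not in $A$. The notation $\mathrm{DNG}(G)=*n$ means that the starting position $\emptyset$ has nim-number $n$. *)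

theory Defs
  imports "HOL-Algebra.Generated_Groups"
begin

definition coxeter_matrix :: "'i set \<Rightarrow> ('i \<Rightarrow> 'i \<Rightarrow> nat) \<Rightarrow> bool" where
  "coxeter_matrix I M \<longleftrightarrow>
     (\<forall>s\<in>I. M s s = 1) \<and>
     (\<forall>s\<in>I. \<forall>t\<in>I. M s t = M t s) \<and>
     (\<forall>s\<in>I. \<forall>t\<in>I. s \<noteq> t \<longrightarrow> M s t \<noteq> 1)"
  (* An entry 0 stands for infinity: the relation (s t)^0 = 1 is void. *)

inductive coxeter_step :: "'i set \<Rightarrow> ('i \<Rightarrow> 'i \<Rightarrow> nat) \<Rightarrow> 'i list \<Rightarrow> 'i list \<Rightarrow> bool"
  for I M where
  "\<lbrakk>u \<in> lists I; v \<in> lists I; s \<in> I; t \<in> I\<rbrakk>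
   \<Longrightarrow> coxeter_step I M (u @ v) (u @ concat (replicate (M s t) [s, t]) @ v)"

definition coxeter_rel :: "'i set \<Rightarrow> ('i \<Rightarrow> 'i \<Rightarrow> nat) \<Rightarrow> ('i list \<times> 'i list) set" where
  "coxeter_rel I M = {(x, y). x \<in> lists I \<and> y \<in> lists I \<and> equivclp (coxeter_step I M) x y}"

(* The group presented by the generators in I and the relations (s t)^(M s t) = 1.
   Formal inverses of the generators are not needed in the words, because the
   relation with s = t says that s s = 1. *)
definition coxeter_group :: "'i set \<Rightarrow> ('i \<Rightarrow> 'i \<Rightarrow> nat) \<Rightarrow> 'i list set monoid" where
  "coxeter_group I M =
     \<lparr>carrier = lists I // coxeter_rel I M,
      mult = (\<lambda>A B. \<Union>x\<in>A. \<Union>y\<in>B. coxeter_rel I M `` {x @ y}),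
      one = coxeter_rel I M `` {[]}\<rparr>"

lemma coxeter_step_lists:
  "coxeter_step I M x y \<Longrightarrow> x \<in> lists I \<and> y \<in> lists I"
  by (induction rule: coxeter_step.induct) (auto split: if_splits)

lemma equiv_coxeter_rel: "equiv (lists I) (coxeter_rel I M)"
proof (rule equivI)
  show "coxeter_rel I M \<subseteq> lists I \<times> lists I" "refl_on (lists I) (coxeter_rel I M)"
    by (auto simp: coxeter_rel_def refl_on_def equivclp_def)
  show "sym (coxeter_rel I M)"
    by (auto simp: coxeter_rel_def sym_def intro: equivclp_sym)
  show "trans (coxeter_rel I M)"
    by (auto simp: coxeter_rel_def trans_def intro: transpD[OF transp_equivclp])
qed

lemma coxeter_step_append:
  assumes "coxeter_step I M x y" "a \<in> lists I" "b \<in> lists I"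
  shows "coxeter_step I M (a @ x @ b) (a @ y @ b)"
  using assms(1)
proof cases
  case (1 u v s t)
  then show ?thesis
    using coxeter_step.intros[of "a @ u" I "v @ b" s t M] assms by simp
qed

lemma equivclp_coxeter_step_append:
  assumes "equivclp (coxeter_step I M) x y" "a \<in> lists I" "b \<in> lists I"
  shows "equivclp (coxeter_step I M) (a @ x @ b) (a @ y @ b)"
  using assms(1)
proof (induction rule: equivclp_induct)
  case base
  then show ?case by (simp add: equivclp_def)
next
  case (step y z)
  then have "coxeter_step I M (a @ y @ b) (a @ z @ b) \<or> coxeter_step I M (a @ z @ b) (a @ y @ b)"
    using coxeter_step_append assms by blast
  then show ?case
    using step.IH by (meson equivclp_into_equivclp)
qed

lemma coxeter_rel_append:
  assumes "(x, x') \<in> coxeter_rel I M" "(y, y') \<in> coxeter_rel I M"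
  shows "(x @ y, x' @ y') \<in> coxeter_rel I M"
proof -
  have "equivclp (coxeter_step I M) (x @ y) (x' @ y)"
    using equivclp_coxeter_step_append[of I M x x' "[]" y] assms by (simp add: coxeter_rel_def)
  moreover have "equivclp (coxeter_step I M) (x' @ y) (x' @ y')"
    using equivclp_coxeter_step_append[of I M y y' "x'" "[]"] assms by (simp add: coxeter_rel_def)
  ultimately have "equivclp (coxeter_step I M) (x @ y) (x' @ y')"
    using transp_equivclp[THEN transpD] by metis
  then show ?thesis using assms by (auto simp: coxeter_rel_def)
qed

lemma coxeter_group_mult:
  assumes "x \<in> lists I" "y \<in> lists I"
  shows "coxeter_rel I M `` {x} \<otimes>\<^bsub>coxeter_group I M\<^esub> coxeter_rel I M `` {y} = coxeter_rel I M `` {x @ y}"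
proof -
  have "congruent2 (coxeter_rel I M) (coxeter_rel I M) (\<lambda>x y. coxeter_rel I M `` {x @ y})"
    by (rule congruent2I') (metis coxeter_rel_append equiv_class_eq equiv_coxeter_rel)
  then show ?thesis
    using UN_equiv_class2[OF equiv_coxeter_rel equiv_coxeter_rel _ assms]
    by (simp add: coxeter_group_def)
qed

lemma coxeter_rel_rev_append:
  assumes "coxeter_matrix I M" "x \<in> lists I"
  shows "(rev x @ x, []) \<in> coxeter_rel I M"
  using assms(2)
proof (induction x)
  case Nil
  then show ?case by (simp add: coxeter_rel_def equivclp_def)
next
  case (Cons s x)
  have "coxeter_step I M (rev x @ x) (rev x @ [s, s] @ x)"
    using coxeter_step.intros[of "rev x" I x s s M] Cons.hyps assms(1)
    by (simp add: coxeter_matrix_def in_lists_conv_set)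
  then have "(rev x @ [s, s] @ x, rev x @ x) \<in> coxeter_rel I M"
    using coxeter_step_lists[of I M "rev x @ x" "rev x @ [s, s] @ x"]
    unfolding coxeter_rel_def by (blast intro: equivclp_sym r_into_equivclp)
  with Cons show ?case
    using equiv_coxeter_rel[of I M] by (auto elim!: equivE dest: transD)
qed

lemma group_coxeter_group:
  assumes "coxeter_matrix I M"
  shows "group (coxeter_group I M)"
proof (rule groupI)
  let ?W = "coxeter_group I M" and ?c = "\<lambda>x. coxeter_rel I M `` {x}"
  have carr: "carrier ?W = ?c ` lists I"
    by (auto simp: coxeter_group_def quotient_def)
  have one: "\<one>\<^bsub>?W\<^esub> = ?c []"
    by (simp add: coxeter_group_def)
  show "x \<otimes>\<^bsub>?W\<^esub> y \<in> carrier ?W" if in_W: "x \<in> carrier ?W" "y \<in> carrier ?W" for x y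
  proof -
    obtain u v where "u \<in> lists I" "v \<in> lists I" "x = ?c u" "y = ?c v"
      using in_W carr by auto
    then have "x \<otimes>\<^bsub>?W\<^esub> y = ?c (u @ v)" "u @ v \<in> lists I"
      by (simp_all add: coxeter_group_mult)
    then show ?thesis unfolding carr by blast
  qed
  show "\<one>\<^bsub>?W\<^esub> \<in> carrier ?W"
    by (auto simp: carr one)
  show "x \<otimes>\<^bsub>?W\<^esub> y \<otimes>\<^bsub>?W\<^esub> z = x \<otimes>\<^bsub>?W\<^esub> (y \<otimes>\<^bsub>?W\<^esub> z)"
    if in_W: "x \<in> carrier ?W" "y \<in> carrier ?W" "z \<in> carrier ?W" for x y z
  proof -
    obtain u v w where "u \<in> lists I" "v \<in> lists I" "w \<in> lists I" "x = ?c u" "y = ?c v" "z = ?c w"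
      using in_W carr by auto
    then show ?thesis by (simp add: coxeter_group_mult)
  qed
  show "\<one>\<^bsub>?W\<^esub> \<otimes>\<^bsub>?W\<^esub> x = x" if in_W: "x \<in> carrier ?W" for x
  proof -
    obtain u where "u \<in> lists I" "x = ?c u"
      using in_W carr by auto
    then show ?thesis by (simp add: one coxeter_group_mult)
  qed
  show "\<exists>y\<in>carrier ?W. y \<otimes>\<^bsub>?W\<^esub> x = \<one>\<^bsub>?W\<^esub>" if in_W: "x \<in> carrier ?W" for x
  proof -
    obtain w where w: "w \<in> lists I" "x = ?c w" using in_W carr by auto
    then have r: "rev w \<in> lists I" by auto
    have "?c (rev w) \<otimes>\<^bsub>?W\<^esub> x = \<one>\<^bsub>?W\<^esub>"
      using w r coxeter_rel_rev_append[OF assms w(1)] equiv_class_eq[OF equiv_coxeter_rel]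
      by (metis coxeter_group_mult one)
    then show ?thesis using r carr by blast
  qed
qed

(* The Coxeter graph on I (an edge joins s and t when M s t is at least 3 or infinite)
   is nonempty and connected. *)
definition coxeter_irreducible :: "'i set \<Rightarrow> ('i \<Rightarrow> 'i \<Rightarrow> nat) \<Rightarrow> bool" where
  "coxeter_irreducible I M \<longleftrightarrow>
     I \<noteq> {} \<and>
     (\<forall>s\<in>I. \<forall>t\<in>I. (s, t) \<in> {(a, b). a \<in> I \<and> b \<in> I \<and> a \<noteq> b \<and> M a b \<noteq> 2}\<^sup>*)"

definition type_A1 :: "'i set \<Rightarrow> bool" where
  "type_A1 I \<longleftrightarrow> (\<exists>s. I = {s})"

definition type_I2 :: "'i set \<Rightarrow> ('i \<Rightarrow> 'i \<Rightarrow> nat) \<Rightarrow> nat \<Rightarrow> bool" where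
  "type_I2 I M m \<longleftrightarrow> m \<ge> 3 \<and> (\<exists>s t. s \<noteq> t \<and> I = {s, t} \<and> M s t = m)"

definition finite_irreducible_coxeter_group ::
    "('a, 'b) monoid_scheme \<Rightarrow> 'i set \<Rightarrow> ('i \<Rightarrow> 'i \<Rightarrow> nat) \<Rightarrow> bool" where
  "finite_irreducible_coxeter_group G I M \<longleftrightarrow>
     group G \<and> finite (carrier G) \<and>
     coxeter_matrix I M \<and> coxeter_irreducible I M \<and> G \<cong> coxeter_group I M"

definition mex :: "nat set \<Rightarrow> nat" where
  "mex A = (LEAST n. n \<notin> A)"

definition dng_positions :: "('a, 'b) monoid_scheme \<Rightarrow> 'a set set" where
  "dng_positions G = {P. P \<subseteq> carrier G \<and> generate G P \<noteq> carrier G}"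

definition dng_option_set :: "('a, 'b) monoid_scheme \<Rightarrow> 'a set \<Rightarrow> 'a set set" where
  "dng_option_set G P = {insert g P |g. g \<in> carrier G - P \<and> insert g P \<in> dng_positions G}"

(* The value 0 for an infinite carrier only serves to make the recursion terminate. *)
function dng_nim :: "('a, 'b) monoid_scheme \<Rightarrow> 'a set \<Rightarrow> nat" where
  "dng_nim G P = (if finite (carrier G) then mex (dng_nim G ` dng_option_set G P) else 0)"
  by pat_completeness auto
termination
proof (relation "measure (\<lambda>(G, P). card (carrier G - P))")
  fix G :: "('a, 'b) monoid_scheme" and P Q
  assume fin: "finite (carrier G)" and "Q \<in> dng_option_set G P"
  then obtain g where "g \<in> carrier G - P" "Q = insert g P"
    by (auto simp: dng_option_set_def)
  then have "carrier G - Q \<subset> carrier G - P" by auto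
  then show "((G, Q), (G, P)) \<in> measure (\<lambda>(G, P). card (carrier G - P))"
    using fin by (simp add: psubset_card_mono)
qed simp

declare dng_nim.simps [simp del]

definition DNG :: "('a, 'b) monoid_scheme \<Rightarrow> nat" where
  "DNG G = dng_nim G {}"

end

theory Submission
  imports Defs "HOL-Algebra.Multiplicative_Group" Complex_Main
begin

text \<open>
The argument rests on two facts about the avoidance game and one about Coxeter groups.

If every subgroup generated in the course of a play has the same parity of order, then the winner
is decided by counting moves, since play stops only at a proper subgroup (\<open>dng_nim_parity\<close>). Let
a finite group have a subgroup \<open>N\<close> of index two. All elements of odd order lie in \<open>N\<close>. If
\<open>N\<close> contains an involution, the second player answers a first move of odd order by this involution,
and the players stay in subgroups of even order; first moves of even order lose by parity. So the
nim-number is 0 (\<open>DNG_eq_0\<close>). If \<open>N\<close> is trivial, the only move is to the identity (\<open>DNG_eq_1\<close>).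
If \<open>N\<close> is nontrivial and cyclic of odd order and all other elements are involutions, then even
games and odd games are both reachable from every position that generates a proper subgroup of
\<open>N\<close>; this yields the nim-number 3 (\<open>DNG_eq_3\<close>).

In a Coxeter group, take for \<open>N\<close> the elements represented by words of even length. One generator
gives trivial \<open>N\<close>, and two generators with an odd label give the dihedral case. In all other cases a
finite group has two generators \<open>s\<close>, \<open>t\<close> with an even label \<open>m\<close>, and then
\<open>(s t)\<^sup>m\<^sup>/\<^sup>2\<close> is an involution in \<open>N\<close> (\<open>DNG_even_entry\<close>). Indeed, infinite labels are impossible
(\<open>entry_nonzero\<close>), and if all labels were odd, there would be three generators, which generate an
infinite triangle group (\<open>no_triangle\<close>). That elements of the abstractly presented group are
nontrivial or of infinite order is seen in the dual of the geometric representation.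
\<close>

section \<open>The avoidance game and parity\<close>

lemma mex_eqI:
  assumes "n \<notin> A" and "\<And>k. k < n \<Longrightarrow> k \<in> A"
  shows "mex A = n"
  unfolding mex_def by (rule Least_equality) (use assms not_less in blast)+

lemma mex_not_member: "finite A \<Longrightarrow> n \<in> A \<Longrightarrow> mex A \<noteq> n"
  unfolding mex_def using LeastI_ex[of "\<lambda>n. n \<notin> A"] ex_new_if_finite[OF infinite_UNIV_nat] by blast

lemma dng_nim_unfold:
  "finite (carrier G) \<Longrightarrow> dng_nim G P = mex (dng_nim G ` dng_option_set G P)"
  by (subst dng_nim.simps) simp

lemma finite_dng_option_set:
  "finite (carrier G) \<Longrightarrow> finite (dng_option_set G P)"
  by (rule finite_subset[of _ "(\<lambda>g. insert g P) ` carrier G"]) (auto simp: dng_option_set_def)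

lemma dng_option_set_cases:
  assumes "Q \<in> dng_option_set G P"
  obtains g where "g \<in> carrier G" "g \<notin> P" "Q = insert g P" "Q \<in> dng_positions G"
  using assms by (auto simp: dng_option_set_def)

context group
begin

text \<open>Along a play the complement of the position shrinks, so the game graph is well founded.\<close>
lemma position_induct [consumes 2, case_names position]:
  assumes fin: "finite (carrier G)" and P: "P \<in> dng_positions G"
    and step: "\<And>P. P \<in> dng_positions G \<Longrightarrow> (\<And>Q. Q \<in> dng_option_set G P \<Longrightarrow> R Q) \<Longrightarrow> R P"
  shows "R P"
  using P
proof (induction "card (carrier G - P)" arbitrary: P rule: less_induct)
  case less
  show ?case
  proof (rule step[OF less.prems])
    fix Q assume "Q \<in> dng_option_set G P"
    then obtain g where g: "g \<in> carrier G" "g \<notin> P" "Q = insert g P" "Q \<in> dng_positions G"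
      by (rule dng_option_set_cases)
    then have "carrier G - Q \<subset> carrier G - P" by auto
    then have "card (carrier G - Q) < card (carrier G - P)"
      using fin by (simp add: psubset_card_mono)
    then show "R Q" using less.hyps g(4) by blast
  qed
qed

lemma generate_insert_absorb:
  assumes "P \<subseteq> carrier G" "g \<in> generate G P"
  shows "generate G (insert g P) = generate G P"
proof
  show "generate G (insert g P) \<subseteq> generate G P"
    using assms by (intro generate_subgroup_incl generate_is_subgroup) (auto intro: generate.incl)
  show "generate G P \<subseteq> generate G (insert g P)"
    by (rule mono_generate) auto
qed

lemma generate_closure_option:
  assumes P: "P \<in> dng_positions G" and g: "g \<in> generate G P" "g \<notin> P"
  shows "insert g P \<in> dng_option_set G P"
proof -
  have PG: "P \<subseteq> carrier G" using P by (simp add: dng_positions_def)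
  have "g \<in> carrier G" using generate_in_carrier[OF PG g(1)] .
  moreover have "insert g P \<in> dng_positions G"
    using P PG \<open>g \<in> carrier G\<close> generate_insert_absorb[OF PG g(1)] by (simp add: dng_positions_def)
  ultimately show ?thesis using g(2) by (auto simp: dng_option_set_def)
qed

lemma card_generate_dvd:
  assumes "P \<subseteq> Q" "Q \<subseteq> carrier G"
  shows "card (generate G P) dvd card (generate G Q)"
proof -
  let ?K = "G\<lparr>carrier := generate G Q\<rparr>"
  have sP: "subgroup (generate G P) G" and sQ: "subgroup (generate G Q) G"
    using assms by (auto intro!: generate_is_subgroup)
  have "subgroup (generate G P) ?K"
    using subgroup_incl[OF sP sQ] mono_generate[OF assms(1)] .
  with subgroup_imp_group[OF sQ]
  have "card (rcosets\<^bsub>?K\<^esub> generate G P) * card (generate G P) = order ?K"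
    by (rule group.lagrange)
  then show ?thesis by (simp add: order_def) (metis dvd_triv_right)
qed

text \<open>If every position reachable from \<^term>\<open>P\<close> generates a subgroup whose order has the parity of
\<^term>\<open>b\<close>, then all plays end with the same parity: a terminal position is a proper subgroup, as
otherwise a missing element of the generated subgroup could be added. So the players only count
moves, and the nim-number is 0 or 1.\<close>
lemma dng_nim_parity:
  assumes fin: "finite (carrier G)" and P: "P \<in> dng_positions G"
    and par: "\<And>Q. Q \<in> dng_positions G \<Longrightarrow> P \<subseteq> Q \<Longrightarrow> card (generate G Q) mod 2 = b mod 2"
  shows "dng_nim G P = (card P + b) mod 2"
  using fin P par
proof (induction P rule: position_induct)
  case (position P)
  have PG: "P \<subseteq> carrier G" using position.hyps by (simp add: dng_positions_def)
  have finP: "finite P" using PG fin finite_subset by blast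
  have opt: "dng_nim G Q = (Suc (card P) + b) mod 2" if Q: "Q \<in> dng_option_set G P" for Q
  proof -
    obtain g where g: "g \<notin> P" "Q = insert g P" using Q by (rule dng_option_set_cases)
    have "dng_nim G Q = (card Q + b) mod 2"
      by (rule position.IH[OF Q]) (use position.prems g in auto)
    then show ?thesis using g finP by simp
  qed
  show ?case
  proof (cases "even (card P + b)")
    case True
    have val: "dng_nim G Q = 1" if "Q \<in> dng_option_set G P" for Q
      using opt[OF that] True by (simp add: mod2_eq_if)
    have "0 \<notin> dng_nim G ` dng_option_set G P"
    proof
      assume "0 \<in> dng_nim G ` dng_option_set G P"
      then obtain Q where "Q \<in> dng_option_set G P" "0 = dng_nim G Q" by blast
      with val show False by fastforce
    qed
    then have "mex (dng_nim G ` dng_option_set G P) = 0" by (rule mex_eqI) simp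
    then show ?thesis using True by (simp add: dng_nim_unfold[OF fin, of P] mod2_eq_if)
  next
    case False
    have "card (generate G P) mod 2 = b mod 2" by (rule position.prems[OF position.hyps]) simp
    then have "generate G P \<noteq> P" using False by (auto simp: mod2_eq_if split: if_splits)
    moreover have "P \<subseteq> generate G P" by (auto intro: generate.incl)
    ultimately obtain g where g: "g \<in> generate G P" "g \<notin> P" by blast
    have ex: "insert g P \<in> dng_option_set G P"
      using generate_closure_option[OF position.hyps g] .
    have val: "dng_nim G Q = 0" if "Q \<in> dng_option_set G P" for Q
      using opt[OF that] False by (simp add: mod2_eq_if)
    have "mex (dng_nim G ` dng_option_set G P) = 1"
    proof (rule mex_eqI)
      show "1 \<notin> dng_nim G ` dng_option_set G P" using val by auto
      show "k \<in> dng_nim G ` dng_option_set G P" if "k < 1" for k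
        using ex val[OF ex] that by force
    qed
    then show ?thesis using False by (simp add: dng_nim_unfold[OF fin, of P] mod2_eq_if)
  qed
qed

text \<open>By Lagrange, evenness of the generated subgroup persists for the rest of the play.\<close>
lemma dng_nim_even_subgroup:
  assumes "finite (carrier G)" "P \<in> dng_positions G" "even (card (generate G P))"
  shows "dng_nim G P = card P mod 2"
proof -
  have "dng_nim G P = (card P + 0) mod 2"
  proof (rule dng_nim_parity[OF assms(1,2)])
    fix Q assume "Q \<in> dng_positions G" "P \<subseteq> Q"
    then have "card (generate G P) dvd card (generate G Q)"
      by (auto simp: dng_positions_def intro!: card_generate_dvd)
    then show "card (generate G Q) mod 2 = 0 mod 2" using assms(3) by auto
  qed
  then show ?thesis by simp
qed

lemma even_card_generate_involution:
  assumes P: "P \<subseteq> carrier G" and t: "t \<in> P" "t \<otimes> t = \<one>" "t \<noteq> \<one>"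
  shows "even (card (generate G P))"
proof -
  have tG: "t \<in> carrier G" using P t by auto
  have "t [^] (2::nat) = \<one>" using t(2) tG by (simp add: numeral_2_eq_2)
  then have "ord t dvd 2" using pow_eq_id[OF tG] by blast
  moreover have "ord t \<noteq> 1" using t(3) ord_eq_1[OF tG] by blast
  moreover have "ord t \<noteq> 0" using calculation(1) by (metis dvd_0_left_iff zero_neq_numeral)
  moreover have "ord t \<le> 2" using calculation(1) by (rule dvd_imp_le) simp
  ultimately have "ord t = 2" by linarith
  then have two: "card (generate G {t}) = 2" using generate_pow_card[OF tG] by simp
  have "card (generate G {t}) dvd card (generate G P)"
    by (rule card_generate_dvd) (use P t(1) in blast)+
  then show ?thesis unfolding two .
qed

end

section \<open>Games on groups with a subgroup of index two\<close>

text \<open>Index two enters only through closure of products of two outside elements. This form is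
immediate for the subgroup of words of even length, and it avoids counting cosets.\<close>
locale index_two_subgroup = group G for G (structure) +
  fixes N
  assumes finite_carrier: "finite (carrier G)"
    and subgroup_N: "subgroup N G"
    and proper_N: "N \<noteq> carrier G"
    and outside_mult: "\<lbrakk>x \<in> carrier G - N; y \<in> carrier G - N\<rbrakk> \<Longrightarrow> x \<otimes> y \<in> N"
begin

lemma N_subset: "N \<subseteq> carrier G"
  using subgroup_N subgroup.subset by blast

lemma inside_mult_outside:
  assumes "x \<in> N" "y \<in> carrier G - N"
  shows "x \<otimes> y \<in> carrier G - N"
proof
  have xG: "x \<in> carrier G" using assms N_subset by blast
  then show "x \<otimes> y \<in> carrier G" using assms by simp
  show "x \<otimes> y \<notin> N"
  proof
    assume "x \<otimes> y \<in> N"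
    then have "inv x \<otimes> (x \<otimes> y) \<in> N"
      using assms(1) subgroup_N by (simp add: subgroup.m_closed subgroup.m_inv_closed)
    moreover have "inv x \<otimes> (x \<otimes> y) = y" using xG assms by (simp flip: m_assoc)
    ultimately show False using assms by simp
  qed
qed

lemma inv_outside: "x \<in> carrier G - N \<Longrightarrow> inv x \<in> carrier G - N"
  using subgroup_N subgroup.m_inv_closed by fastforce

lemma N_maximal:
  assumes "subgroup H G" "N \<subseteq> H" "H \<noteq> carrier G"
  shows "H = N"
proof (rule ccontr)
  assume "H \<noteq> N"
  then obtain x where x: "x \<in> H" "x \<notin> N" using assms(2) by blast
  have xG: "x \<in> carrier G" using x(1) assms(1) subgroup.subset by blast
  have "y \<in> H" if y: "y \<in> carrier G" for y
  proof (cases "y \<in> N")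
    case False
    have "inv x \<otimes> y \<in> N" using outside_mult inv_outside x xG y False by auto
    then have "x \<otimes> (inv x \<otimes> y) \<in> H" using assms x by (meson subgroup.m_closed subsetD)
    then show ?thesis using xG y by (simp flip: m_assoc)
  qed (use assms in auto)
  then show False using assms subgroup.subset by blast
qed

text \<open>The powers of an outside element alternate between outside and inside, so an odd power of it
cannot be the identity.\<close>
lemma odd_order_in_N:
  assumes g: "g \<in> carrier G" and odd: "odd (card (generate G {g}))"
  shows "g \<in> N"
proof (rule ccontr)
  assume gN: "g \<notin> N"
  have sq: "g \<otimes> g \<in> N" using outside_mult g gN by simp
  have "g [^] (2 * k) \<in> N" for k :: nat
  proof (induction k)
    case 0
    then show ?case using subgroup_N by (simp add: subgroup.one_closed)
  next
    case (Suc k)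
    have "g [^] (2 * Suc k) = g [^] (2 * k) \<otimes> (g \<otimes> g)"
      using g by (simp add: m_assoc)
    then show ?case using Suc sq subgroup_N by (simp add: subgroup.m_closed)
  qed
  then have "g [^] (2 * k) \<otimes> g \<notin> N" for k :: nat using inside_mult_outside g gN by auto
  then have "g [^] Suc (2 * k) \<notin> N" for k :: nat by simp
  moreover have "odd (ord g)" using odd generate_pow_card[OF g] by simp
  then obtain k where "ord g = Suc (2 * k)" by (metis oddE Suc_eq_plus1)
  ultimately have "g [^] ord g \<notin> N" by metis
  then show False using g subgroup_N by (simp add: subgroup.one_closed)
qed

text \<open>No first move wins. If the first move \<^term>\<open>g\<close> has even
order, the position \<^term>\<open>{g}\<close> has an odd number of elements in an even game, hence nim-number 1.
If \<^term>\<open>g\<close> has odd order, it lies in \<^term>\<open>N\<close> together with the involution \<^term>\<open>t\<close>, so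
\<^term>\<open>{t, g}\<close> is a legal position of nim-number 0. In both cases the option \<^term>\<open>{g}\<close> of the
empty position is nonzero.\<close>
lemma DNG_eq_0:
  assumes t: "t \<in> N" "t \<otimes> t = \<one>" "t \<noteq> \<one>"
  shows "DNG G = 0"
proof -
  have "dng_nim G Q \<noteq> 0" if opt: "Q \<in> dng_option_set G {}" for Q
  proof -
    obtain g where g: "g \<in> carrier G" "Q = {g}" and pos: "{g} \<in> dng_positions G"
      using opt by (auto elim: dng_option_set_cases)
    show ?thesis
    proof (cases "even (card (generate G {g}))")
      case True
      then show ?thesis using dng_nim_even_subgroup[OF finite_carrier pos True] g by simp
    next
      case False
      have gN: "g \<in> N" using odd_order_in_N[OF g(1) False] .
      have tG: "t \<in> carrier G" using t N_subset by blast
      have ne: "t \<noteq> g"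
        using False even_card_generate_involution[of "{g}" g] g(1) t by auto
      have "generate G {t, g} \<subseteq> N" using gN t subgroup_N by (intro generate_subgroup_incl) auto
      then have pos': "{t, g} \<in> dng_positions G"
        using proper_N N_subset g tG by (auto simp: dng_positions_def)
      then have opt': "{t, g} \<in> dng_option_set G {g}"
        using ne tG by (auto simp: dng_option_set_def)
      have "even (card (generate G {t, g}))"
        using even_card_generate_involution[of "{t, g}" t] t tG g by auto
      from dng_nim_even_subgroup[OF finite_carrier pos' this]
      have "dng_nim G {t, g} = 0" using ne by simp
      then have "0 \<in> dng_nim G ` dng_option_set G {g}" using opt' by force
      then have "mex (dng_nim G ` dng_option_set G {g}) \<noteq> 0"
        by (intro mex_not_member finite_imageI finite_dng_option_set finite_carrier)
      then show ?thesis using g by (simp add: dng_nim_unfold[OF finite_carrier, of "{g}"])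
    qed
  qed
  then have "0 \<notin> dng_nim G ` dng_option_set G {}" by (metis imageE)
  then have "mex (dng_nim G ` dng_option_set G {}) = 0" by (rule mex_eqI) simp
  then show ?thesis by (simp add: DNG_def dng_nim_unfold[OF finite_carrier, of "{}"])
qed

text \<open>Once a position generates the maximal subgroup \<^term>\<open>N\<close>, play is confined to it.\<close>
lemma dng_nim_generates_N:
  assumes P: "P \<subseteq> carrier G" and gen: "generate G P = N"
  shows "dng_nim G P = (card P + card N) mod 2"
proof (rule dng_nim_parity[OF finite_carrier])
  show "P \<in> dng_positions G" using assms proper_N by (simp add: dng_positions_def)
  fix Q assume Q: "Q \<in> dng_positions G" "P \<subseteq> Q"
  then have "generate G Q = N"
    using mono_generate[OF Q(2)] gen
    by (intro N_maximal generate_is_subgroup) (auto simp: dng_positions_def)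
  then show "card (generate G Q) mod 2 = card N mod 2" by simp
qed

lemma DNG_eq_1:
  assumes "N = {\<one>}"
  shows "DNG G = 1"
  using dng_nim_generates_N[of "{}"] assms generate_empty by (simp add: DNG_def)

end

text \<open>For cyclic \<^term>\<open>N\<close> this is a dihedral group of order twice an odd number: rotations inside,
reflections outside. The relations needed below follow from the outside elements being involutions.\<close>
locale odd_generalized_dihedral = index_two_subgroup +
  assumes odd_N: "odd (card N)"
    and outside_involution: "x \<in> carrier G - N \<Longrightarrow> x \<otimes> x = \<one>"
begin

lemma conj_inverts:
  assumes "x \<in> carrier G - N" "c \<in> N"
  shows "x \<otimes> c \<otimes> x = inv c"
proof -
  have G: "x \<in> carrier G" "c \<in> carrier G" using assms N_subset by auto
  have "c \<otimes> x \<in> carrier G - N" using inside_mult_outside assms by blast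
  then have "(c \<otimes> x) \<otimes> (c \<otimes> x) = \<one>" by (rule outside_involution)
  then have "c \<otimes> (x \<otimes> c \<otimes> x) = \<one>" using G by (simp add: m_assoc)
  then show ?thesis using G by (metis inv_comm inv_equality m_closed)
qed

text \<open>A reflection \<^term>\<open>x\<close> inverts the subgroup \<^term>\<open>H\<close> generated by \<^term>\<open>P\<close>, so \<^term>\<open>H\<close> and its
coset by \<^term>\<open>x\<close> form a subgroup. It meets \<^term>\<open>N\<close> only in \<^term>\<open>H\<close>, hence is proper.\<close>
lemma insert_outside_position:
  assumes P: "P \<subseteq> N" "generate G P \<noteq> N" and x: "x \<in> carrier G - N"
  shows "insert x P \<in> dng_positions G"
proof -
  define H where "H = generate G P"
  have xG: "x \<in> carrier G" and PG: "P \<subseteq> carrier G" using x P N_subset by auto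
  have sH: "subgroup H G" unfolding H_def by (rule generate_is_subgroup[OF PG])
  have HN: "H \<subseteq> N" unfolding H_def by (rule generate_subgroup_incl[OF P(1) subgroup_N])
  then have HG: "H \<subseteq> carrier G" using N_subset by blast
  note closed = subgroup.m_closed[OF sH] subgroup.m_inv_closed[OF sH]
  have xx: "x \<otimes> x = \<one>" using x by (rule outside_involution)
  have swap: "h \<otimes> x = x \<otimes> inv h" if "h \<in> H" for h
  proof -
    have hG: "h \<in> carrier G" using that HG by blast
    have "x \<otimes> (x \<otimes> h \<otimes> x) = x \<otimes> inv h" using conj_inverts x that HN by auto
    moreover have "x \<otimes> (x \<otimes> h \<otimes> x) = h \<otimes> x"
      using xG hG xx by (simp flip: m_assoc)
    ultimately show ?thesis by simp
  qed
  define K where "K = H \<union> (\<lambda>h. x \<otimes> h) ` H"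
  have invx: "inv x = x" using xx xG by (simp add: inv_equality)
  have "subgroup K G"
  proof (rule subgroupI)
    show "K \<subseteq> carrier G" using HG xG by (auto simp: K_def)
    show "K \<noteq> {}" using subgroup.one_closed[OF sH] by (auto simp: K_def)
  next
    fix a assume "a \<in> K"
    then consider "a \<in> H" | h where "h \<in> H" "a = x \<otimes> h" by (auto simp: K_def)
    then show "inv a \<in> K"
    proof cases
      case 2
      have hG: "h \<in> carrier G" using 2 HG by blast
      have "inv a = inv h \<otimes> x" using 2 hG xG by (simp add: inv_mult_group invx)
      also have "\<dots> = x \<otimes> h" using swap[of "inv h"] closed 2 hG by simp
      finally show ?thesis using 2 by (auto simp: K_def)
    qed (use closed in \<open>auto simp: K_def\<close>)
  next
    fix a b assume ab: "a \<in> K" "b \<in> K"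
    have mixed: "h \<otimes> (x \<otimes> h') = x \<otimes> (inv h \<otimes> h')" if "h \<in> H" "h' \<in> H" for h h'
    proof -
      have G: "h \<in> carrier G" "h' \<in> carrier G" using that HG by auto
      have "h \<otimes> (x \<otimes> h') = (h \<otimes> x) \<otimes> h'" using G xG by (simp add: m_assoc)
      also have "\<dots> = x \<otimes> (inv h \<otimes> h')" using G xG swap[OF that(1)] by (simp add: m_assoc)
      finally show ?thesis .
    qed
    consider "a \<in> H" "b \<in> H" | h where "a \<in> H" "h \<in> H" "b = x \<otimes> h"
      | h where "h \<in> H" "a = x \<otimes> h" "b \<in> H"
      | h h' where "h \<in> H" "a = x \<otimes> h" "h' \<in> H" "b = x \<otimes> h'"
      using ab by (auto simp: K_def)
    then show "a \<otimes> b \<in> K"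
    proof cases
      case 1
      then show ?thesis using closed by (auto simp: K_def)
    next
      case (2 h)
      then show ?thesis using mixed closed by (auto simp: K_def)
    next
      case (3 h)
      then have "a \<otimes> b = x \<otimes> (h \<otimes> b)" using xG HG by (simp add: m_assoc subsetD)
      then show ?thesis using closed 3 by (auto simp: K_def)
    next
      case (4 h h')
      have G: "h \<in> carrier G" "h' \<in> carrier G" using 4 HG by auto
      have "a \<otimes> b = x \<otimes> (h \<otimes> (x \<otimes> h'))" using 4 G xG by (simp add: m_assoc)
      also have "\<dots> = x \<otimes> (x \<otimes> (inv h \<otimes> h'))" using mixed 4 by simp
      also have "\<dots> = inv h \<otimes> h'" using G xG xx by (simp flip: m_assoc)
      finally show ?thesis using closed 4 by (auto simp: K_def)
    qed
  qed
  moreover have "insert x P \<subseteq> K"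
  proof -
    have "x \<otimes> \<one> \<in> K" using subgroup.one_closed[OF sH] unfolding K_def by blast
    then have "x \<in> K" using xG by simp
    moreover have "P \<subseteq> H" unfolding H_def by (auto intro: generate.incl)
    ultimately show ?thesis by (auto simp: K_def)
  qed
  ultimately have "generate G (insert x P) \<subseteq> K" by (intro generate_subgroup_incl)
  moreover have "K \<noteq> carrier G"
  proof -
    obtain c where c: "c \<in> N" "c \<notin> H" using P(2) HN by (auto simp: H_def)
    have "x \<otimes> h \<notin> N" if "h \<in> H" for h
    proof -
      have "inv h \<otimes> x \<in> carrier G - N"
        using inside_mult_outside x closed HN that by blast
      then show ?thesis using swap[of "inv h"] closed that HG by auto
    qed
    then have "c \<notin> K" using c by (auto simp: K_def)
    then show ?thesis using c N_subset by blast
  qed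
  ultimately have "generate G (insert x P) \<noteq> carrier G"
    using \<open>subgroup K G\<close> subgroup.subset by fast
  then show ?thesis using PG xG by (simp add: dng_positions_def)
qed

lemma even_card_generate_outside:
  assumes "P \<subseteq> carrier G" "x \<in> P" "x \<notin> N"
  shows "even (card (generate G P))"
  using assms outside_involution[of x] subgroup.one_closed[OF subgroup_N]
  by (intro even_card_generate_involution[of P x]) auto

text \<open>Three kinds of moves are available from a set of rotations that does not generate \<^term>\<open>N\<close>.
Adding a reflection leads to an even game, and adding a generator of \<^term>\<open>N\<close> to an odd game
with equally many elements; so these two kinds yield exactly the nim-numbers 0 and 1. The remaining
moves stay among positions of the same kind and flip the parity of the cardinality. Thus the values
2 and 3 alternate: an odd set sees no 2, and an even set always sees a 2 because it differs from the
subgroup of odd order that it generates.\<close>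
lemma dng_nim_inside:
  assumes c: "c \<in> N" "generate G {c} = N"
    and P: "P \<subseteq> N" "generate G P \<noteq> N"
  shows "dng_nim G P = (if even (card P) then 3 else 2)"
proof -
  have "P \<in> dng_positions G"
    using P N_subset proper_N generate_subgroup_incl[OF P(1) subgroup_N]
    by (auto simp: dng_positions_def)
  with finite_carrier show ?thesis using P
  proof (induction P rule: position_induct)
    case (position P)
    note PN = position.prems
    have PG: "P \<subseteq> carrier G" using PN N_subset by blast
    have finP: "finite P" using PG finite_carrier finite_subset by blast
    let ?V = "dng_nim G ` dng_option_set G P"
    obtain x where x: "x \<in> carrier G - N" using proper_N N_subset by blast
    have xP: "x \<notin> P" using x PN by blast
    have outside: "dng_nim G (insert y P) = Suc (card P) mod 2"
      if y: "y \<in> carrier G - N" for y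
    proof -
      have "even (card (generate G (insert y P)))"
        using even_card_generate_outside[of "insert y P" y] y PG by auto
      from dng_nim_even_subgroup[OF finite_carrier insert_outside_position[OF PN y] this]
      show ?thesis using y PN finP by (subst (asm) card_insert_disjoint) auto
    qed
    have filling: "dng_nim G (insert y P) = card P mod 2"
      if y: "y \<in> N" "y \<notin> P" "generate G (insert y P) = N" for y
    proof -
      have "dng_nim G (insert y P) = (card (insert y P) + card N) mod 2"
        by (rule dng_nim_generates_N) (use PG y N_subset in auto)
      also have "\<dots> = (Suc (card P) + card N) mod 2" using finP y by simp
      also have "\<dots> = card P mod 2" using odd_N by presburger
      finally show ?thesis .
    qed
    have inside: "dng_nim G (insert y P) = (if even (card P) then 2 else 3)"
      if y: "insert y P \<in> dng_option_set G P" "y \<in> N" "y \<notin> P" "generate G (insert y P) \<noteq> N" for y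
      using position.IH[OF y(1)] PN y finP by auto
    have "c \<notin> P"
      using PN c mono_generate[of "{c}" P] generate_subgroup_incl[OF PN(1) subgroup_N] by auto
    have genc: "generate G (insert c P) = N"
    proof
      show "generate G (insert c P) \<subseteq> N"
        using c PN by (intro generate_subgroup_incl subgroup_N) auto
      show "N \<subseteq> generate G (insert c P)" using c mono_generate[of "{c}" "insert c P"] by auto
    qed
    have optx: "insert x P \<in> dng_option_set G P"
      using insert_outside_position[OF PN x] x xP by (auto simp: dng_option_set_def)
    have optc: "insert c P \<in> dng_option_set G P"
      using genc proper_N c N_subset PG \<open>c \<notin> P\<close> by (auto simp: dng_option_set_def dng_positions_def)
    have in01: "Suc (card P) mod 2 \<in> ?V" "card P mod 2 \<in> ?V"
      using optx outside[OF x] optc filling[OF c(1) \<open>c \<notin> P\<close> genc] by (metis imageI)+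
    then have small: "k \<in> ?V" if "k < 2" for k
    proof -
      have "k = Suc (card P) mod 2 \<or> k = card P mod 2" using that by (auto simp: mod2_eq_if)
      then show ?thesis using in01 by metis
    qed
    have all: "v \<in> {0, 1, if even (card P) then 2 else 3}" if vV: "v \<in> ?V" for v
    proof -
      obtain Q where Q: "Q \<in> dng_option_set G P" "v = dng_nim G Q" using vV by blast
      from Q(1) obtain y where "y \<in> carrier G" "y \<notin> P" "Q = insert y P"
        by (rule dng_option_set_cases)
      with Q have y: "y \<in> carrier G" "y \<notin> P" "insert y P \<in> dng_option_set G P"
        "v = dng_nim G (insert y P)" by simp_all
      consider "y \<notin> N" | "y \<in> N" "generate G (insert y P) = N"
        | "y \<in> N" "generate G (insert y P) \<noteq> N" by blast
      then show ?thesis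
      proof cases
        case 1
        then show ?thesis using outside[of y] y by (auto simp: mod2_eq_if)
      next
        case 2
        then show ?thesis using filling[of y] y by (auto simp: mod2_eq_if)
      next
        case 3
        then show ?thesis using inside[of y] y by auto
      qed
    qed
    have "mex ?V = (if even (card P) then 3 else 2)"
    proof (cases "even (card P)")
      case True
      have "odd (card (generate G P))"
      proof -
        have "generate G N = N"
          using generate_subgroup_incl[OF _ subgroup_N] by (auto intro: generate.incl)
        then have "card (generate G P) dvd card N"
          using card_generate_dvd[OF PN(1) N_subset] by simp
        then show ?thesis using odd_N dvd_trans by blast
      qed
      then have "generate G P \<noteq> P" using True by auto
      moreover have "P \<subseteq> generate G P" by (auto intro: generate.incl)
      ultimately obtain y where y: "y \<in> generate G P" "y \<notin> P" by blast
      have "y \<in> N" using y generate_subgroup_incl[OF PN(1) subgroup_N] by auto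
      moreover have "generate G (insert y P) \<noteq> N"
        using generate_insert_absorb[OF PG y(1)] PN by simp
      moreover have opty: "insert y P \<in> dng_option_set G P"
        by (rule generate_closure_option[OF position.hyps y])
      ultimately have "dng_nim G (insert y P) = 2" using inside[of y] y True by simp
      then have "2 \<in> ?V" using opty by (metis imageI)
      then have "k \<in> ?V" if "k < 3" for k
        using that small by (cases "k = 2") auto
      moreover have "3 \<notin> ?V" using all[of 3] True by auto
      ultimately show ?thesis using True by (intro mex_eqI) auto
    next
      case False
      have "2 \<notin> ?V" using all[of 2] False by auto
      then show ?thesis using False small by (intro mex_eqI) auto
    qed
    then show ?case by (simp add: dng_nim_unfold[OF finite_carrier, of P])
  qed
qed

lemma DNG_eq_3:
  assumes "c \<in> N" "generate G {c} = N" "c \<noteq> \<one>"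
  shows "DNG G = 3"
  using dng_nim_inside[OF assms(1,2), of "{}"] assms generate_empty by (auto simp: DNG_def)

end

section \<open>The dual geometric representation\<close>

text \<open>The contragredient of the geometric representation, also known as the numbers game: firing the node
\<^term>\<open>s\<close> negates the number there and adds multiples of it to its neighbours. Acting on arbitrary
functions, rather than on vectors of finite support, allows any index set. The conventions for
division make the formula uniform: the diagonal entry 1 gives the coefficient \<open>-2\<close>, and the entry 0,
which stands for infinity, gives the coefficient 2.\<close>
definition reflect :: "('i \<Rightarrow> 'i \<Rightarrow> nat) \<Rightarrow> 'i \<Rightarrow> ('i \<Rightarrow> real) \<Rightarrow> 'i \<Rightarrow> real" where
  "reflect M s f = (\<lambda>r. f r + 2 * cos (pi / M s r) * f s)"

lemma two_cos_ge_1: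
  assumes "n \<noteq> 1" "n \<noteq> (2::nat)"
  shows "1 \<le> 2 * cos (pi / n)"
proof (cases "n = 0")
  case False
  then have "3 \<le> n" using assms by linarith
  then have "pi / n \<le> pi / 3" by (intro divide_left_mono) auto
  moreover have "0 \<le> pi / n" by simp
  ultimately have "cos (pi / 3) \<le> cos (pi / n)" by (intro cos_monotone_0_pi_le) auto
  then show ?thesis by (simp add: cos_60)
qed simp

text \<open>The closed form of the sequence of values that are fired when two nodes with label \<^term>\<open>m\<close> are fired
alternately, starting with \<^term>\<open>p\<close> and \<^term>\<open>q\<close>: the solution of the Chebyshev recurrence
with these initial values. A real argument permits steps back from 0.\<close>
definition fired :: "nat \<Rightarrow> real \<Rightarrow> real \<Rightarrow> real \<Rightarrow> real" where
  "fired m p q x = (q * sin (x * (pi / m)) - p * sin ((x - 1) * (pi / m))) / sin (pi / m)"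

lemma fired_recurrence:
  fixes x :: real
  shows "fired m p q (x + 1) = 2 * cos (pi / m) * fired m p q x - fired m p q (x - 1)"
proof -
  define \<theta> where "\<theta> = pi / m"
  have 1: "sin ((x + 1) * \<theta>) = 2 * cos \<theta> * sin (x * \<theta>) - sin ((x - 1) * \<theta>)" for x :: real
    by (simp add: algebra_simps sin_add sin_diff)
  have "sin (x * \<theta>) = 2 * cos \<theta> * sin ((x - 1) * \<theta>) - sin ((x - 1 - 1) * \<theta>)"
    using 1[of "x - 1"] by simp
  then show ?thesis
    unfolding fired_def \<theta>_def[symmetric] using 1[of x]
    by (simp add: divide_simps) (simp add: algebra_simps)
qed

lemma fired_antiperiodic:
  fixes x :: real
  assumes "m > 0"
  shows "fired m p q (x + m) = - fired m p q x"
proof -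
  have 1: "sin ((y + m) * (pi / m)) = - sin (y * (pi / m))" for y :: real
  proof -
    have "(y + m) * (pi / m) = y * (pi / m) + pi" using assms by (simp add: field_simps)
    then show ?thesis by simp
  qed
  have 2: "x + real m - 1 = (x - 1) + real m" by simp
  show ?thesis unfolding fired_def 2 1 by (simp add: diff_divide_distrib)
qed

lemma sin_pi_div_pos: "2 \<le> m \<Longrightarrow> 0 < sin (pi / real m)"
  by (intro sin_gt_zero) (auto simp: field_simps)

text \<open>Over a full period, the recurrence relates the sum \<open>E\<close> over even indices and the sum \<open>O'\<close> over odd
indices by \<open>2 E = c O'\<close> and \<open>2 O' = c E\<close>, where \<open>c\<^sup>2 < 4\<close>. Hence both vanish.\<close>
lemma fired_sums_zero:
  assumes m: "2 \<le> m"
  shows "(\<Sum>j<m. fired m p q (2 * real j)) = 0" "(\<Sum>j<m. fired m p q (2 * real j + 1)) = 0"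
proof -
  define c where "c = 2 * cos (pi / m)"
  define E where "E = (\<Sum>j<m. fired m p q (2 * real j))"
  define O' where "O' = (\<Sum>j<m. fired m p q (2 * real j + 1))"
  have period: "fired m p q (x + 2 * m) = fired m p q x" for x :: real
    using fired_antiperiodic[of m p q x] fired_antiperiodic[of m p q "x + m"] m by (simp add: add.assoc)
  have shift: "(\<Sum>j<m. fired m p q (x + 2 * (real j + 1))) = (\<Sum>j<m. fired m p q (x + 2 * real j))" for x :: real
  proof -
    let ?g = "\<lambda>j::nat. fired m p q (x + 2 * real j)"
    have "sum ?g {..<Suc m} = ?g 0 + (\<Sum>j<m. ?g (Suc j))"
      by (rule sum.lessThan_Suc_shift)
    moreover have "?g m = ?g 0" using period[of x] by simp
    ultimately have "(\<Sum>j<m. ?g (Suc j)) = sum ?g {..<m}" by simp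
    then show ?thesis by (simp add: add.commute)
  qed
  have "E + E = (\<Sum>j<m. fired m p q (2 * real j) + fired m p q (0 + 2 * (real j + 1)))"
    using shift[of 0] by (simp add: E_def sum.distrib)
  also have "\<dots> = (\<Sum>j<m. c * fired m p q (2 * real j + 1))"
  proof (rule sum.cong[OF refl])
    fix j :: nat
    show "fired m p q (2 * real j) + fired m p q (0 + 2 * (real j + 1)) = c * fired m p q (2 * real j + 1)"
      using fired_recurrence[of m p q "2 * real j + 1"] by (simp add: c_def algebra_simps)
  qed
  finally have 1: "2 * E = c * O'" by (simp add: O'_def sum_distrib_left)
  have "O' + O' = (\<Sum>j<m. fired m p q (-1 + 2 * real j) + fired m p q (-1 + 2 * (real j + 1)))"
    using shift[of "-1"] by (simp add: O'_def sum.distrib algebra_simps)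
  also have "\<dots> = (\<Sum>j<m. c * fired m p q (2 * real j))"
  proof (rule sum.cong[OF refl])
    fix j :: nat
    show "fired m p q (-1 + 2 * real j) + fired m p q (-1 + 2 * (real j + 1)) = c * fired m p q (2 * real j)"
      using fired_recurrence[of m p q "2 * real j"] by (simp add: c_def algebra_simps)
  qed
  finally have 2: "2 * O' = c * E" by (simp add: E_def sum_distrib_left)
  have "(cos (pi / m))\<^sup>2 < 1"
    using sin_pi_div_pos[OF m] sin_cos_squared_add[of "pi / m"] by (smt (verit) zero_less_power)
  then have c: "4 - c\<^sup>2 \<noteq> 0" by (simp add: c_def power_mult_distrib)
  have "2 * (2 * E) = c * (2 * O')" unfolding 1 by simp
  then have "4 * E = c\<^sup>2 * E" unfolding 2 by (simp add: power2_eq_square)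
  then have "(4 - c\<^sup>2) * E = 0" by (simp add: algebra_simps)
  then have "E = 0" using c by simp
  then have "O' = 0" using 2 by simp
  show "(\<Sum>j<m. fired m p q (2 * real j)) = 0" using \<open>E = 0\<close> by (simp add: E_def)
  show "(\<Sum>j<m. fired m p q (2 * real j + 1)) = 0" using \<open>O' = 0\<close> by (simp add: O'_def)
qed

text \<open>Every node accumulates a fixed multiple of each value fired at \<^term>\<open>s\<close> or \<^term>\<open>t\<close>, so the whole
orbit is determined by the sequence of fired values. The formula for \<^term>\<open>F r\<close> holds at
\<^term>\<open>s\<close> and \<^term>\<open>t\<close> as well.\<close>
lemma reflect_pair_orbit:
  fixes f :: "'i \<Rightarrow> real" and k :: nat
  assumes M: "M s s = 1" "M t t = 1" "M t s = M s t" and m: "2 \<le> M s t"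
  defines "(y :: real \<Rightarrow> real) \<equiv> fired (M s t) (f t) (f s + 2 * cos (pi / M s t) * f t)"
    and "F \<equiv> ((reflect M s \<circ> reflect M t) ^^ k) f"
  shows "F t = y (2 * real k)"
    and "F s = y (2 * real k + 1) - 2 * cos (pi / M s t) * y (2 * real k)"
    and "F r = f r + 2 * cos (pi / M t r) * (\<Sum>j<k. y (2 * real j))
                   + 2 * cos (pi / M s r) * (\<Sum>j<k. y (2 * real j + 1))"
proof -
  have y0: "y 0 = f t" using sin_pi_div_pos[OF m] by (simp add: y_def fired_def)
  have y1: "y 1 = f s + 2 * cos (pi / M s t) * f t"
    using sin_pi_div_pos[OF m] by (simp add: y_def fired_def)
  have rec: "y (x + 1) = 2 * cos (pi / M s t) * y x - y (x - 1)" for x :: real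
    unfolding y_def by (rule fired_recurrence)
  have "F t = y (2 * real k) \<and> F s = y (2 * real k + 1) - 2 * cos (pi / M s t) * y (2 * real k) \<and>
    (\<forall>r. F r = f r + 2 * cos (pi / M t r) * (\<Sum>j<k. y (2 * real j))
                   + 2 * cos (pi / M s r) * (\<Sum>j<k. y (2 * real j + 1)))"
    unfolding F_def
  proof (induction k)
    case 0
    then show ?case by (simp add: y0 y1)
  next
    case (Suc k)
    define g where "g = ((reflect M s \<circ> reflect M t) ^^ k) f"
    define c where "c = 2 * cos (pi / M s t)"
    have gt: "g t = y (2 * real k)" and gs: "g s = y (2 * real k + 1) - c * y (2 * real k)"
      and gr: "g r = f r + 2 * cos (pi / M t r) * (\<Sum>j<k. y (2 * real j))
                   + 2 * cos (pi / M s r) * (\<Sum>j<k. y (2 * real j + 1))" for r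
      using Suc unfolding g_def c_def by blast+
    have step: "((reflect M s \<circ> reflect M t) ^^ Suc k) f r =
        g r + 2 * cos (pi / M t r) * y (2 * real k) + 2 * cos (pi / M s r) * y (2 * real k + 1)" for r
      by (simp add: g_def[symmetric] reflect_def gt gs M c_def[symmetric])
    have y2: "y (2 * real k + 2) = c * y (2 * real k + 1) - y (2 * real k)"
      using rec[of "2 * real k + 1"] by (simp add: c_def algebra_simps)
    have y3: "y (2 * real k + 3) = c * y (2 * real k + 2) - y (2 * real k + 1)"
      using rec[of "2 * real k + 2"] by (simp add: c_def algebra_simps)
    have arg: "2 * real (Suc k) = 2 * real k + 2" "2 * real k + 2 + 1 = 2 * real k + 3" by simp_all
    have "((reflect M s \<circ> reflect M t) ^^ Suc k) f t = y (2 * real (Suc k))"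
      unfolding step arg using y2 by (simp add: gt M c_def)
    moreover have "((reflect M s \<circ> reflect M t) ^^ Suc k) f s
        = y (2 * real (Suc k) + 1) - 2 * cos (pi / M s t) * y (2 * real (Suc k))"
      unfolding step arg using y3 by (simp add: gs M c_def)
    ultimately show ?case unfolding step by (simp add: gr algebra_simps)
  qed
  then show "F t = y (2 * real k)" "F s = y (2 * real k + 1) - 2 * cos (pi / M s t) * y (2 * real k)"
    "F r = f r + 2 * cos (pi / M t r) * (\<Sum>j<k. y (2 * real j))
                   + 2 * cos (pi / M s r) * (\<Sum>j<k. y (2 * real j + 1))" by blast+
qed

text \<open>After \<^term>\<open>M s t\<close> rounds the fired values of either node sum to zero, so no node has changed.\<close>
lemma reflect_relation:
  assumes M: "coxeter_matrix I M" and st: "s \<in> I" "t \<in> I"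
  shows "(reflect M s \<circ> reflect M t) ^^ M s t = id"
proof (cases "s = t")
  case True
  then show ?thesis using M st by (simp add: coxeter_matrix_def reflect_def fun_eq_iff)
next
  case False
  then have m1: "M s t \<noteq> 1" and diag: "M s s = 1" "M t t = 1" "M t s = M s t"
    using M st by (auto simp: coxeter_matrix_def)
  show ?thesis
  proof (cases "M s t = 0")
    case False
    then have m: "2 \<le> M s t" using m1 by linarith
    show ?thesis
    proof (intro ext)
      fix f :: "'a \<Rightarrow> real" and r
      show "((reflect M s \<circ> reflect M t) ^^ M s t) f r = id f r"
        by (subst reflect_pair_orbit(3)[OF diag m]) (simp add: fired_sums_zero[OF m])
    qed
  qed simp
qed

text \<open>Half of the rounds fire \<^term>\<open>M s t\<close> values, a half period, after which the number at
\<^term>\<open>t\<close> has changed its sign.\<close>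
lemma reflect_half_relation:
  assumes M: "coxeter_matrix I M" and st: "s \<in> I" "t \<in> I" "s \<noteq> t" and m: "M s t = 2 * h" "h \<noteq> 0"
  shows "(reflect M s \<circ> reflect M t) ^^ h \<noteq> id"
proof
  assume id: "(reflect M s \<circ> reflect M t) ^^ h = id"
  have diag: "M s s = 1" "M t t = 1" "M t s = M s t" and m2: "2 \<le> M s t"
    using M st m by (auto simp: coxeter_matrix_def)
  define f :: "'a \<Rightarrow> real" where "f = (\<lambda>r. 1)"
  define q where "q = f s + 2 * cos (pi / M s t) * f t"
  have "((reflect M s \<circ> reflect M t) ^^ h) f t = fired (M s t) (f t) q (2 * real h)"
    unfolding q_def by (rule reflect_pair_orbit(1)[OF diag m2])
  also have "2 * real h = 0 + real (M s t)" using m by simp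
  also have "fired (M s t) (f t) q (0 + real (M s t)) = - fired (M s t) (f t) q 0"
    using m2 by (intro fired_antiperiodic) simp
  also have "\<dots> = - f t" using sin_pi_div_pos[OF m2] by (simp add: fired_def)
  finally show False unfolding id by (simp add: f_def)
qed

section \<open>Evaluation of words\<close>

lemma foldr_concat_replicate: "foldr f (concat (replicate n w)) = foldr f w ^^ n"
  by (induction n) (auto simp: fun_eq_iff)

lemma coxeter_rel_reflect:
  assumes M: "coxeter_matrix I M" and uv: "(u, v) \<in> coxeter_rel I M"
  shows "foldr (reflect M) u = foldr (reflect M) v"
proof -
  have step: "foldr (reflect M) x = foldr (reflect M) y" if "coxeter_step I M x y" for x y
    using that
  proof cases
    case (1 u v s t)
    have "foldr (reflect M) [s, t] = reflect M s \<circ> reflect M t" by auto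
    then have "foldr (reflect M) (concat (replicate (M s t) [s, t])) = id"
      using 1 reflect_relation[OF M, of s t] by (simp only: foldr_concat_replicate)
    then show ?thesis unfolding 1 by (intro ext) simp
  qed
  have "equivclp (coxeter_step I M) u v" using uv by (simp add: coxeter_rel_def)
  then show ?thesis by (induction rule: equivclp_induct) (auto dest: step)
qed

lemma coxeter_rel_even_length:
  assumes uv: "(u, v) \<in> coxeter_rel I M"
  shows "even (length u) = even (length v)"
proof -
  have step: "even (length x) = even (length y)" if "coxeter_step I M x y" for x y
    using that by cases (auto simp: length_concat sum_list_replicate)
  have "equivclp (coxeter_step I M) u v" using uv by (simp add: coxeter_rel_def)
  then show ?thesis by (induction rule: equivclp_induct) (auto dest: step)
qed

text \<open>A finite Coxeter group up to isomorphism, seen through the evaluation \<^term>\<open>ev\<close> of words in the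
generators. Working with words keeps equivalence classes and the isomorphism out of the arguments.\<close>
locale finite_coxeter_evaluation = group G for G (structure) +
  fixes I :: "'i set" and M :: "'i \<Rightarrow> 'i \<Rightarrow> nat" and ev :: "'i list \<Rightarrow> 'a"
  assumes finite_carrier: "finite (carrier G)"
    and matrix: "coxeter_matrix I M"
    and ev_append: "\<lbrakk>u \<in> lists I; v \<in> lists I\<rbrakk> \<Longrightarrow> ev (u @ v) = ev u \<otimes> ev v"
    and carrier_eq: "carrier G = ev ` lists I"
    and ev_eq_iff: "\<lbrakk>u \<in> lists I; v \<in> lists I\<rbrakk> \<Longrightarrow> ev u = ev v \<longleftrightarrow> (u, v) \<in> coxeter_rel I M"
begin

lemma ev_closed [simp]: "w \<in> lists I \<Longrightarrow> ev w \<in> carrier G"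
  by (auto simp: carrier_eq)

lemma ev_Nil [simp]: "ev [] = \<one>"
  using ev_append[of "[]" "[]"] ev_closed[of "[]"] l_cancel_one' by force

lemma ev_rev: "w \<in> lists I \<Longrightarrow> ev (rev w) = inv (ev w)"
proof -
  assume w: "w \<in> lists I"
  then have r: "rev w \<in> lists I" by auto
  have "ev (rev w @ w) = ev []"
    using ev_eq_iff[of "rev w @ w" "[]"] coxeter_rel_rev_append[OF matrix w] w r by auto
  then have "ev (rev w) \<otimes> ev w = \<one>" using w r ev_append by simp
  then show ?thesis using w r by (metis ev_closed inv_equality)
qed

lemma concat_replicate_lists: "w \<in> lists I \<Longrightarrow> concat (replicate n w) \<in> lists I"
  by (induction n) auto

lemma ev_concat_replicate:
  assumes "w \<in> lists I"
  shows "ev (concat (replicate n w)) = ev w [^] n"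
proof (induction n)
  case (Suc n)
  have "ev (concat (replicate (Suc n) w)) = ev w \<otimes> ev w [^] n"
    using Suc assms concat_replicate_lists ev_append by simp
  then show ?case using assms ev_closed nat_pow_Suc2 by simp
qed simp

lemma ev_relation:
  assumes "s \<in> I" "t \<in> I"
  shows "ev [s, t] [^] M s t = \<one>"
proof -
  have "coxeter_step I M ([] @ []) ([] @ concat (replicate (M s t) [s, t]) @ [])"
    using assms by (intro coxeter_step.intros) auto
  then have "equivclp (coxeter_step I M) (concat (replicate (M s t) [s, t])) []"
    by (simp add: equivclp_sym r_into_equivclp)
  moreover have "concat (replicate (M s t) [s, t]) \<in> lists I"
    using assms by (intro concat_replicate_lists) auto
  ultimately have "ev (concat (replicate (M s t) [s, t])) = ev []"
    by (subst ev_eq_iff) (auto simp: coxeter_rel_def)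
  then show ?thesis using assms ev_concat_replicate[of "[s, t]" "M s t"] by simp
qed

lemma ev_generator_square:
  assumes "s \<in> I"
  shows "ev [s] \<otimes> ev [s] = \<one>"
proof -
  have "M s s = 1" using assms matrix by (simp add: coxeter_matrix_def)
  then show ?thesis using ev_relation[of s s] ev_append[of "[s]" "[s]"] assms by simp
qed

lemma reflect_eq_of_ev_eq:
  assumes "u \<in> lists I" "v \<in> lists I" "ev u = ev v"
  shows "foldr (reflect M) u = foldr (reflect M) v"
  using assms ev_eq_iff coxeter_rel_reflect[OF matrix] by blast

text \<open>The rotation subgroup, that is, the kernel of the sign character.\<close>
definition rotations :: "'a set" where
  "rotations = ev ` {w \<in> lists I. even (length w)}"

lemma ev_in_rotations_iff:
  assumes "w \<in> lists I"
  shows "ev w \<in> rotations \<longleftrightarrow> even (length w)"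
proof
  assume "ev w \<in> rotations"
  then obtain v where "v \<in> lists I" "even (length v)" "ev w = ev v" by (auto simp: rotations_def)
  then show "even (length w)" using assms ev_eq_iff coxeter_rel_even_length by blast
qed (use assms in \<open>auto simp: rotations_def\<close>)

lemma index_two_rotations:
  assumes "I \<noteq> {}"
  shows "index_two_subgroup G rotations"
proof (intro index_two_subgroup.intro index_two_subgroup_axioms.intro group_axioms)
  show "finite (carrier G)" by (rule finite_carrier)
  show "subgroup rotations G"
  proof (rule subgroupI)
    show "rotations \<subseteq> carrier G" unfolding rotations_def carrier_eq by blast
    show "rotations \<noteq> {}" using ev_in_rotations_iff[of "[]"] by auto
  next
    fix a assume "a \<in> rotations"
    then obtain w where w: "w \<in> lists I" "even (length w)" "a = ev w" by (auto simp: rotations_def)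
    then have "rev w \<in> lists I" by auto
    then have "ev (rev w) \<in> rotations" using w by (subst ev_in_rotations_iff) auto
    then show "inv a \<in> rotations" using w by (simp add: ev_rev)
  next
    fix a b assume "a \<in> rotations" "b \<in> rotations"
    then obtain u v where "u \<in> lists I" "even (length u)" "a = ev u"
      "v \<in> lists I" "even (length v)" "b = ev v" by (auto simp: rotations_def)
    then show "a \<otimes> b \<in> rotations" using ev_in_rotations_iff[of "u @ v"] ev_append by simp
  qed
  obtain s where s: "s \<in> I" using assms by blast
  then have "ev [s] \<notin> rotations" by (subst ev_in_rotations_iff) auto
  then show "rotations \<noteq> carrier G" using s ev_closed[of "[s]"] by auto
  fix x y assume "x \<in> carrier G - rotations" "y \<in> carrier G - rotations"
  then obtain u v where "u \<in> lists I" "x = ev u" "v \<in> lists I" "y = ev v" "x \<notin> rotations" "y \<notin> rotations"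
    by (auto simp: carrier_eq)
  then show "x \<otimes> y \<in> rotations" using ev_in_rotations_iff[of "u @ v"] ev_in_rotations_iff[of u] ev_in_rotations_iff[of v] ev_append
    by simp
qed

text \<open>Every element of a finite group has a positive power that is the identity, so it cannot keep increasing
a coordinate in the representation.\<close>
lemma no_unbounded_orbit:
  assumes w: "w \<in> lists I" and f: "R f"
    and grow: "\<And>f. R f \<Longrightarrow> R (foldr (reflect M) w f) \<and> f r < foldr (reflect M) w f r"
  shows False
proof -
  let ?A = "foldr (reflect M) w"
  have le: "R ((?A ^^ k) f) \<and> f r \<le> (?A ^^ k) f r" for k
  proof (induction k)
    case (Suc k)
    then show ?case using grow[of "(?A ^^ k) f"] by auto
  qed (use f in simp)
  have less: "f r < (?A ^^ Suc k) f r" for k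
    using le[of k] grow[of "(?A ^^ k) f"] by auto
  have "order G > 0" using finite_carrier order_gt_0_iff_finite by blast
  then obtain k where k: "order G = Suc k" using not0_implies_Suc by blast
  have "ev (concat (replicate (Suc k) w)) = ev []"
    using pow_order_eq_1[of "ev w"] ev_concat_replicate[OF w] w k by (metis ev_Nil ev_closed)
  then have "foldr (reflect M) (concat (replicate (Suc k) w)) = foldr (reflect M) []"
    by (intro reflect_eq_of_ev_eq concat_replicate_lists w) auto
  then have "?A ^^ Suc k = id" unfolding foldr_concat_replicate by auto
  then show False using less[of k] by (metis id_apply less_irrefl)
qed

lemma matrix_diag: "s \<in> I \<Longrightarrow> M s s = 1"
  and matrix_sym: "s \<in> I \<Longrightarrow> t \<in> I \<Longrightarrow> M s t = M t s"
  and matrix_ne_1: "s \<in> I \<Longrightarrow> t \<in> I \<Longrightarrow> s \<noteq> t \<Longrightarrow> M s t \<noteq> 1"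
  using matrix by (auto simp: coxeter_matrix_def)

text \<open>With an infinite label, alternate firing follows the recurrence
\<open>x\<^sub>n\<^sub>+\<^sub>1 = 2 x\<^sub>n - x\<^sub>n\<^sub>-\<^sub>1\<close>, whose solutions grow linearly.
The invariant says that the next two fired values are positive and increasing.\<close>
lemma entry_nonzero:
  assumes st: "s \<in> I" "t \<in> I"
  shows "M s t \<noteq> 0"
proof
  assume 0: "M s t = 0"
  have M: "M s s = 1" "M t t = 1" "M t s = 0" using 0 st matrix_diag matrix_sym by auto
  show False
  proof (rule no_unbounded_orbit[where w = "[t, s]" and r = s and f = "\<lambda>_. 1"
        and R = "\<lambda>f. 0 < f s \<and> 0 < f s + f t"])
    show "[t, s] \<in> lists I" using st by simp
    fix f :: "'i \<Rightarrow> real" assume "0 < f s \<and> 0 < f s + f t"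
    then show "(0 < foldr (reflect M) [t, s] f s \<and>
        0 < foldr (reflect M) [t, s] f s + foldr (reflect M) [t, s] f t) \<and>
      f s < foldr (reflect M) [t, s] f s"
      by (simp add: reflect_def M 0)
  qed simp
qed

text \<open>Three pairwise non-commuting generators span a triangle group of affine or hyperbolic type, which is
infinite. Fired cyclically, each value is at least the sum of the two preceding ones minus the one
before, because all coefficients are at least 1; so an increasing start keeps increasing.\<close>
lemma no_triangle:
  assumes rst: "r \<in> I" "s \<in> I" "t \<in> I" and ne: "r \<noteq> s" "s \<noteq> t" "r \<noteq> t"
    and ne2: "M r s \<noteq> 2" "M s t \<noteq> 2" "M r t \<noteq> 2"
  shows False
proof -
  define a b c where "a = 2 * cos (pi / M r s)" and "b = 2 * cos (pi / M s t)"
    and "c = 2 * cos (pi / M r t)"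
  have ge: "1 \<le> a" "1 \<le> b" "1 \<le> c"
    unfolding a_def b_def c_def using matrix_ne_1 rst ne ne2 by (auto intro!: two_cos_ge_1)
  have M: "M r r = 1" "M s s = 1" "M t t = 1" "M s r = M r s" "M t s = M s t" "M t r = M r t"
    using rst matrix_diag matrix_sym by auto
  show False
  proof (rule no_unbounded_orbit[where w = "[t, s, r]" and r = r and f = "\<lambda>_. 1"
        and R = "\<lambda>f. 0 < f r \<and> 0 < f s \<and> 0 < f r + f t"])
    show "[t, s, r] \<in> lists I" using rst by simp
    fix f :: "'i \<Rightarrow> real" assume f: "0 < f r \<and> 0 < f s \<and> 0 < f r + f t"
    \<comment> \<open>\<open>y\<close> and \<open>z\<close> are the values fired at \<open>s\<close> and \<open>t\<close>, after \<open>f r\<close> at \<open>r\<close>.\<close>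
    define y where "y = f s + a * f r"
    define z where "z = f t + c * f r + b * y"
    let ?g = "foldr (reflect M) [t, s, r] f"
    have g: "?g r = - f r + a * y + c * z" "?g s = - y + b * z" "?g t = - z"
      by (simp_all add: reflect_def M a_def b_def c_def y_def z_def algebra_simps)
    have le: "x \<le> d * x" if "1 \<le> d" "0 < x" for d x :: real using that by simp
    have "f r \<le> a * f r" "f r \<le> c * f r" using f le ge by blast+
    then have y: "f r < y" and z': "b * y < z" using f unfolding y_def z_def by linarith+
    then have z: "y < z" using le[OF ge(2), of y] f by linarith
    have "a * y \<ge> y" "b * z \<ge> z" "c * z \<ge> z" using le ge y z f by auto
    then show "(0 < ?g r \<and> 0 < ?g s \<and> 0 < ?g r + ?g t) \<and> f r < ?g r"
      unfolding g using f y z by linarith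
  qed simp
qed

lemma rotation_ne_one:
  assumes st: "s \<in> I" "t \<in> I" "s \<noteq> t" and m: "M s t \<noteq> 2"
  shows "ev [s, t] \<noteq> \<one>"
proof
  assume "ev [s, t] = \<one>"
  then have "foldr (reflect M) [s, t] = foldr (reflect M) []"
    using st by (intro reflect_eq_of_ev_eq) auto
  then have "foldr (reflect M) [s, t] (\<lambda>r. if r = t then 1 else 0) s = 0" using st by simp
  then have "2 * cos (pi / M s t) = 0"
    using st matrix_diag matrix_sym[of s t] by (simp add: reflect_def)
  then show False using two_cos_ge_1[of "M s t"] matrix_ne_1 st m by auto
qed

lemma DNG_rank_one:
  assumes I: "I = {s}"
  shows "DNG G = 1"
proof -
  interpret index_two_subgroup G rotations using I by (intro index_two_rotations) auto
  have "ev w = \<one>" if "w \<in> lists I" "even (length w)" for w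
    using that
  proof (induction w rule: induct_list012)
    case (3 a b w)
    then have "a = s" "b = s" "ev w = \<one>" using I by auto
    then have "ev ([s] @ [s] @ w) = ev [s] \<otimes> (ev [s] \<otimes> ev w)"
      using 3 ev_append[of "[s]" "[s] @ w"] ev_append[of "[s]" w] by (simp del: append_Cons)
    then show ?case using \<open>a = s\<close> \<open>b = s\<close> \<open>ev w = \<one>\<close> ev_generator_square[of s] I by simp
  qed auto
  then have "rotations = {\<one>}" using ev_in_rotations_iff[of "[]"] by (auto simp: rotations_def)
  then show ?thesis by (rule DNG_eq_1)
qed

text \<open>The rotations are the powers of \<^term>\<open>ev [s, t]\<close>, whose order divides the odd number
\<^term>\<open>M s t\<close>, and every other element is a generator times such a power, hence an involution.\<close>
lemma DNG_dihedral_odd: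
  assumes I: "I = {s, t}" "s \<noteq> t" and m: "odd (M s t)"
  shows "DNG G = 3"
proof -
  interpret index_two_subgroup G rotations using I by (intro index_two_rotations) auto
  have st: "s \<in> I" "t \<in> I" using I by auto
  define \<rho> where "\<rho> = ev [s, t]"
  have st_G: "ev [s] \<in> carrier G" "ev [t] \<in> carrier G" using st by auto
  have \<rho>: "\<rho> = ev [s] \<otimes> ev [t]" using ev_append[of "[s]" "[t]"] st by (simp add: \<rho>_def)
  have sq: "ev [s] \<otimes> ev [s] = \<one>" "ev [t] \<otimes> ev [t] = \<one>" using ev_generator_square st by auto
  have \<rho>G: "\<rho> \<in> carrier G" using st_G \<rho> by simp
  have \<rho>_in: "\<rho> \<in> rotations" unfolding \<rho>_def using st by (subst ev_in_rotations_iff) auto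
  have sub: "subgroup (generate G {\<rho>}) G" using \<rho>G by (intro generate_is_subgroup) simp
  have pair: "ev [a, b] \<in> generate G {\<rho>}" if "a \<in> I" "b \<in> I" for a b
  proof -
    have "ev [s, s] = \<one>" "ev [t, t] = \<one>" "ev [t, s] = inv \<rho>"
      using sq ev_append[of "[s]" "[s]"] ev_append[of "[t]" "[t]"] ev_rev[of "[s, t]"] st
      by (simp_all add: \<rho>_def)
    then show ?thesis
      using that I by (auto simp: \<rho>_def[symmetric] intro: generate.intros)
  qed
  have "ev w \<in> generate G {\<rho>}" if "w \<in> lists I" "even (length w)" for w
    using that
  proof (induction w rule: induct_list012)
    case (3 a b w)
    then have "ev ([a, b] @ w) = ev [a, b] \<otimes> ev w" by (intro ev_append) auto
    then show ?case using 3 pair[of a b] by (auto intro: generate.eng)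
  qed (auto intro: generate.one)
  then have "rotations \<subseteq> generate G {\<rho>}" by (auto simp: rotations_def)
  then have N_eq: "generate G {\<rho>} = rotations"
    using generate_subgroup_incl[OF _ subgroup_N, of "{\<rho>}"] \<rho>_in by auto
  interpret odd_generalized_dihedral G rotations
  proof
    have "ord \<rho> dvd M s t" using ev_relation[OF st] \<rho>G pow_eq_id by (simp add: \<rho>_def)
    then show "odd (card rotations)" using m generate_pow_card[OF \<rho>G] N_eq dvd_trans by metis
  next
    fix x assume x: "x \<in> carrier G - rotations"
    have "ev [s] \<in> carrier G - rotations" using st ev_in_rotations_iff[of "[s]"] by auto
    then have "ev [s] \<otimes> x \<in> rotations" using outside_mult x by blast
    then obtain k :: nat where k: "ev [s] \<otimes> x = \<rho> [^] k"
      using generate_pow_on_finite_carrier[OF finite_carrier \<rho>G] N_eq by auto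
    \<comment> \<open>The reflection \<open>ev [s]\<close> inverts \<open>\<rho>\<close>; this form suits the induction on the exponent.\<close>
    have flip: "\<rho> \<otimes> ev [s] \<otimes> \<rho> = ev [s]"
    proof -
      have "\<rho> \<otimes> ev [s] \<otimes> \<rho> = ev [s] \<otimes> (ev [t] \<otimes> (ev [s] \<otimes> ev [s]) \<otimes> ev [t])"
        unfolding \<rho> using st_G by (simp add: m_assoc)
      then show ?thesis using sq st_G by simp
    qed
    have pow: "\<rho> [^] k \<otimes> ev [s] \<otimes> \<rho> [^] k = ev [s]" for k :: nat
    proof (induction k)
      case (Suc k)
      have "\<rho> [^] Suc k \<otimes> ev [s] \<otimes> \<rho> [^] Suc k = \<rho> [^] k \<otimes> (\<rho> \<otimes> ev [s] \<otimes> \<rho>) \<otimes> \<rho> [^] k"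
      proof -
        have "\<rho> [^] Suc k \<otimes> ev [s] \<otimes> \<rho> [^] Suc k = (\<rho> [^] k \<otimes> \<rho>) \<otimes> ev [s] \<otimes> (\<rho> \<otimes> \<rho> [^] k)"
          by (simp only: nat_pow_Suc2[OF \<rho>G, symmetric] nat_pow_Suc)
        also have "\<dots> = \<rho> [^] k \<otimes> (\<rho> \<otimes> ev [s] \<otimes> \<rho>) \<otimes> \<rho> [^] k"
          using \<rho>G st_G by (simp add: m_assoc)
        finally show ?thesis .
      qed
      then show ?case using flip Suc by simp
    qed (use st_G in simp)
    have x_eq: "x = ev [s] \<otimes> \<rho> [^] k"
    proof -
      have "ev [s] \<otimes> (ev [s] \<otimes> x) = x" using st_G sq x by (simp flip: m_assoc)
      then show ?thesis using k by simp
    qed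
    have "x \<otimes> x = ev [s] \<otimes> (\<rho> [^] k \<otimes> ev [s] \<otimes> \<rho> [^] k)"
      unfolding x_eq using st_G \<rho>G by (simp add: m_assoc)
    then show "x \<otimes> x = \<one>" using pow sq by simp
  qed
  have "\<rho> \<noteq> \<one>"
    unfolding \<rho>_def by (rule rotation_ne_one[OF st I(2)]) (use m in auto)
  then show ?thesis using DNG_eq_3[OF \<rho>_in N_eq] by simp
qed

text \<open>The involution in the rotation subgroup is \<^term>\<open>ev [s, t]\<close> raised to half of \<^term>\<open>M s t\<close>. It is not
the identity because it acts nontrivially in the representation.\<close>
lemma DNG_even_entry:
  assumes st: "s \<in> I" "t \<in> I" "s \<noteq> t" and m: "even (M s t)"
  shows "DNG G = 0"
proof -
  interpret index_two_subgroup G rotations using st by (intro index_two_rotations) auto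
  obtain h where h: "M s t = 2 * h" using m by blast
  then have h0: "h \<noteq> 0" using entry_nonzero st by fastforce
  define w where "w = concat (replicate h [s, t])"
  have w: "w \<in> lists I" unfolding w_def using st by (intro concat_replicate_lists) auto
  have ev_w: "ev w = ev [s, t] [^] h" unfolding w_def using st by (intro ev_concat_replicate) auto
  show ?thesis
  proof (rule DNG_eq_0)
    show "ev w \<in> rotations" using ev_in_rotations_iff[OF w] by (simp add: w_def length_concat sum_list_replicate)
    show "ev w \<otimes> ev w = \<one>"
      using ev_relation[of s t] st h unfolding ev_w
      by (simp add: nat_pow_mult mult_2[symmetric])
    show "ev w \<noteq> \<one>"
    proof
      assume "ev w = \<one>"
      then have "foldr (reflect M) w = foldr (reflect M) []"
        using w by (intro reflect_eq_of_ev_eq) auto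
      moreover have "foldr (reflect M) [s, t] = reflect M s \<circ> reflect M t" by auto
      ultimately have "(reflect M s \<circ> reflect M t) ^^ h = id"
        unfolding w_def foldr_concat_replicate by auto
      then show False using reflect_half_relation[OF matrix st h h0] by simp
    qed
  qed
qed

end

lemma finite_coxeter_evaluation_exists:
  assumes "finite_irreducible_coxeter_group G I M"
  shows "\<exists>ev. finite_coxeter_evaluation G I M ev"
proof -
  let ?W = "coxeter_group I M" and ?c = "\<lambda>x. coxeter_rel I M `` {x}"
  have G: "group G" "finite (carrier G)" "coxeter_matrix I M" "G \<cong> ?W"
    using assms by (auto simp: finite_irreducible_coxeter_group_def)
  have W: "group ?W" by (rule group_coxeter_group[OF G(3)])
  obtain h where h: "h \<in> iso ?W G" using group.iso_sym[OF G(1) G(4)] by (auto simp: is_iso_def)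
  have carr: "carrier ?W = ?c ` lists I" by (auto simp: coxeter_group_def quotient_def)
  have "finite_coxeter_evaluation G I M (\<lambda>w. h (?c w))"
  proof (intro finite_coxeter_evaluation.intro finite_coxeter_evaluation_axioms.intro G(1-3))
    show "h (?c (u @ v)) = h (?c u) \<otimes>\<^bsub>G\<^esub> h (?c v)" if "u \<in> lists I" "v \<in> lists I" for u v
    proof -
      have "h (?c u \<otimes>\<^bsub>?W\<^esub> ?c v) = h (?c u) \<otimes>\<^bsub>G\<^esub> h (?c v)"
        using h that carr by (intro hom_mult[of h]) (auto simp: iso_def)
      then show ?thesis using that by (simp add: coxeter_group_mult)
    qed
    have bij: "bij_betw h (carrier ?W) (carrier G)" using h by (simp add: iso_def)
    then show "carrier G = (\<lambda>w. h (?c w)) ` lists I"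
      using carr by (simp add: bij_betw_def image_image)
    show "h (?c u) = h (?c v) \<longleftrightarrow> (u, v) \<in> coxeter_rel I M" if "u \<in> lists I" "v \<in> lists I" for u v
    proof -
      have "h (?c u) = h (?c v) \<longleftrightarrow> ?c u = ?c v"
        using bij that carr by (intro inj_on_eq_iff[of h "carrier ?W"]) (auto simp: bij_betw_def)
      also have "\<dots> \<longleftrightarrow> (u, v) \<in> coxeter_rel I M"
        using eq_equiv_class_iff[OF equiv_coxeter_rel that] .
      finally show ?thesis .
    qed
  qed
  then show ?thesis by blast
qed

theorem corollary7p9:
  fixes G :: "('a, 'b) monoid_scheme"
    and I :: "'i set"
    and M :: "'i \<Rightarrow> 'i \<Rightarrow> nat"
  assumes "finite_irreducible_coxeter_group G I M"
  shows "(type_A1 I \<longrightarrow> DNG G = 1) \<and>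
         ((\<exists>m. odd m \<and> type_I2 I M m) \<longrightarrow> DNG G = 3) \<and>
         (\<not> type_A1 I \<and> \<not> (\<exists>m. odd m \<and> type_I2 I M m) \<longrightarrow> DNG G = 0)"
proof -
  obtain ev where "finite_coxeter_evaluation G I M ev"
    using finite_coxeter_evaluation_exists[OF assms] by blast
  then interpret finite_coxeter_evaluation G I M ev .
  show ?thesis
  proof (intro conjI impI)
    assume "type_A1 I"
    then show "DNG G = 1" unfolding type_A1_def using DNG_rank_one by blast
  next
    assume "\<exists>m. odd m \<and> type_I2 I M m"
    then show "DNG G = 3" unfolding type_I2_def using DNG_dihedral_odd by blast
  next
    assume other: "\<not> type_A1 I \<and> \<not> (\<exists>m. odd m \<and> type_I2 I M m)"
    \<comment> \<open>If all labels were odd, a third generator would exist and give a triangle of odd labels.\<close>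
    have "\<exists>s\<in>I. \<exists>t\<in>I. s \<noteq> t \<and> even (M s t)"
    proof (rule ccontr)
      assume "\<not> (\<exists>s\<in>I. \<exists>t\<in>I. s \<noteq> t \<and> even (M s t))"
      then have odd: "odd (M s t)" if "s \<in> I" "t \<in> I" "s \<noteq> t" for s t using that by blast
      have "I \<noteq> {}"
        using assms by (simp add: finite_irreducible_coxeter_group_def coxeter_irreducible_def)
      then obtain s where s: "s \<in> I" by blast
      then obtain t where t: "t \<in> I" "s \<noteq> t" using other by (auto simp: type_A1_def)
      have "M s t \<noteq> 1" using matrix_ne_1[OF s t] .
      then have "3 \<le> M s t" using odd[OF s t] by presburger
      then have "I \<noteq> {s, t}" using other odd[OF s t] t(2) unfolding type_I2_def by blast
      then obtain r where r: "r \<in> I" "r \<noteq> s" "r \<noteq> t" using s t by blast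
      show False
        by (rule no_triangle[OF r(1) s t(1)]) (use odd[of r s] odd[of s t] odd[of r t] r s t in auto)
    qed
    then show "DNG G = 0" using DNG_even_entry by blast
  qed
qed

end
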